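(* Let $\mathbb{H}$ be a real Hilbert space and let $A\ne0$ be a positive bounded linear operator on $\mathbb{H}$ such that $B_{\mathbb{H}(A)}\cap\overline{R(A)}$ is bounded with respect to $\|\cdot\|$. Let $\epsilon\in[0,1)$ and let $T,S\in B_{A^{1/2}}(\mathbb{H})$ be compact operators. Then $T\bot_{\epsilon(A)}S$ if and only if there exists $x\in\mathbb{H}$ with $\|x\|_A=1$ such that $\|Tx\|_A=\|T\|_A$ and $|\langle Tx,Sx\rangle_A|\le\epsilon\|T\|_A\|S\|_A$.
   Context: $\|\cdot\|$ is the Hilbert space norm of $\mathbb{H}$; compactness is with respect to it. A bounded linear operator $A$ on $\mathbb{H}$ is positive if $A=A^*$ and $\langle Ax,x\rangle\ge0$ for all $x$; $R(A)$ is its range and the closure $\overline{R(A)}$ is in $\|\cdot\|$. Put $\langle x,y\rangle_A=\langle Ax,y\rangle$, $\|x\|_A=\sqrt{\langle Ax,x\rangle}$, $B_{\mathbb{H}(A)}=\{x\in\mathbb{H}:\|x\|_A\le1\}$. $B_{A^{1/2}}(\mathbb{H})$ is the set of $A$-bounded operators, i.e. bounded linear operators $T$ on $\mathbb{H}$ for which there is $c>0$ with $\|Tx\|_A\le c\|x\|_A$ for all $x\in\mathbb{H}$; for such $T$, $\|T\|_A=\sup\{\|Tx\|_A:\|x\|_A=1\}$. For $T,S\in B_{A^{1/2}}(\mathbb{H})$, $T\bot_{\epsilon(A)}S$ means $\|T+\lambda S\|_A^2\ge\|T\|_A^2-2\epsilon\|T\|_A\|\lambda S\|_A$ for all scalars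 $\lambda$. *)

theory Defs
  imports "HOL-Analysis.Analysis"
begin

text \<open>
  A real Hilbert space is a type of sort \<open>{real_inner, complete_space}\<close>; bounded linear operators
  on it are the elements of \<open>'a \<Rightarrow>\<^sub>L 'a\<close>.
\<close>

text \<open>
  The condition \<open>A = A\<^sup>*\<close> is written as the defining property of the adjoint, with \<open>A\<close> itself in
  the role of its adjoint; compare \<open>positive_op_adjoint\<close> below.
\<close>

definition positive_op :: "('a::real_inner \<Rightarrow>\<^sub>L 'a) \<Rightarrow> bool" where
  "positive_op A \<longleftrightarrow> (\<forall>x y. A x \<bullet> y = x \<bullet> A y) \<and> (\<forall>x. 0 \<le> A x \<bullet> x)"

lemma positive_op_adjoint:
  "positive_op A \<Longrightarrow> adjoint (blinfun_apply A) = blinfun_apply A"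
  by (rule adjoint_unique) (simp add: positive_op_def)

definition compact_op :: "('a::real_normed_vector \<Rightarrow>\<^sub>L 'b::real_normed_vector) \<Rightarrow> bool" where
  "compact_op T \<longleftrightarrow> compact (closure (T ` cball 0 1))"

definition A_inner :: "('a::real_inner \<Rightarrow>\<^sub>L 'a) \<Rightarrow> 'a \<Rightarrow> 'a \<Rightarrow> real" where
  "A_inner A x y = A x \<bullet> y"

definition A_norm :: "('a::real_inner \<Rightarrow>\<^sub>L 'a) \<Rightarrow> 'a \<Rightarrow> real" where
  "A_norm A x = sqrt (A_inner A x x)"

definition A_ball :: "('a::real_inner \<Rightarrow>\<^sub>L 'a) \<Rightarrow> 'a set" where
  "A_ball A = {x. A_norm A x \<le> 1}"

definition A_bounded_ops :: "('a::real_inner \<Rightarrow>\<^sub>L 'a) \<Rightarrow> ('a \<Rightarrow>\<^sub>L 'a) set" where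
  "A_bounded_ops A = {T :: 'a \<Rightarrow>\<^sub>L 'a. \<exists>c>0. \<forall>x. A_norm A (T x) \<le> c * A_norm A x}"

text \<open>
  The supremum is taken in \<open>real\<close>, so it is meaningful when \<open>A \<noteq> 0\<close> is positive (the set is
  nonempty) and \<open>T \<in> A_bounded_ops A\<close> (the set is bounded above).
\<close>

definition A_opnorm :: "('a::real_inner \<Rightarrow>\<^sub>L 'a) \<Rightarrow> ('a \<Rightarrow>\<^sub>L 'a) \<Rightarrow> real" where
  "A_opnorm A T = (SUP x\<in>{x. A_norm A x = 1}. A_norm A (T x))"

definition approx_orthogonal ::
    "real \<Rightarrow> ('a::real_inner \<Rightarrow>\<^sub>L 'a) \<Rightarrow> ('a \<Rightarrow>\<^sub>L 'a) \<Rightarrow> ('a \<Rightarrow>\<^sub>L 'a) \<Rightarrow> bool" where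
  "approx_orthogonal \<epsilon> A T S \<longleftrightarrow>
     (\<forall>t::real. (A_opnorm A (T + t *\<^sub>R S))\<^sup>2
        \<ge> (A_opnorm A T)\<^sup>2 - 2 * \<epsilon> * A_opnorm A T * A_opnorm A (t *\<^sub>R S))"

end

theory Submission
  imports Defs
begin

text \<open>
  The hypothesis on \<open>A_ball A\<close> says that \<open>A_norm A\<close> is equivalent to the norm on the closed
  subspace \<open>closure (range A)\<close>, and \<open>A\<close>-bounded operators do not see the complementary kernel
  of \<open>A\<close>. For \<open>t \<down> 0\<close> take near-maximisers \<open>x\<^sub>t\<close> of \<open>T + t S\<close> in this subspace. By compactness
  \<open>T x\<^sub>t\<close> converges along a subsequence, and since \<open>\<parallel>T x\<^sub>t\<parallel>\<^sub>A \<rightarrow> \<parallel>T\<parallel>\<^sub>A\<close> the parallelogram law makes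
  \<open>x\<^sub>t\<close> itself Cauchy; the limit \<open>x\<close> attains \<open>\<parallel>T\<parallel>\<^sub>A\<close> and satisfies the lower bound for
  \<open>\<langle>T x, S x\<rangle>\<^sub>A\<close>. The same argument for \<open>-S\<close> gives a second point with the upper bound, and the
  points attaining \<open>\<parallel>T\<parallel>\<^sub>A\<close> span a subspace of such points, so the intermediate value theorem on
  the segment joining the two yields a point where both bounds hold.
\<close>

section \<open>Closures of linear subspaces\<close>

lemma subspace_closure:
  fixes V :: "'a::real_normed_vector set"
  assumes "subspace V"
  shows "subspace (closure V)"
proof (rule subspaceI)
  show "0 \<in> closure V"
    using subspace_0[OF assms] closure_subset by blast
next
  fix x y assume "x \<in> closure V" "y \<in> closure V"
  then obtain f g where f: "\<And>n. f n \<in> V" "f \<longlonglongrightarrow> x" and g: "\<And>n. g n \<in> V" "g \<longlonglongrightarrow> y"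
    unfolding closure_sequential by blast
  have "\<forall>n. f n + g n \<in> V"
    using subspace_add[OF assms f(1) g(1)] by blast
  with tendsto_add[OF f(2) g(2)] show "x + y \<in> closure V"
    unfolding closure_sequential by (intro exI conjI)
next
  fix r x assume "x \<in> closure V"
  then obtain f where f: "\<And>n. f n \<in> V" "f \<longlonglongrightarrow> x"
    unfolding closure_sequential by blast
  have "\<forall>n. r *\<^sub>R f n \<in> V"
    using subspace_scale[OF assms f(1)] by blast
  with tendsto_scaleR[OF tendsto_const[of r] f(2)] show "r *\<^sub>R x \<in> closure V"
    unfolding closure_sequential by (intro exI conjI)
qed

lemma subspace_closure_range:
  fixes T :: "'a::real_normed_vector \<Rightarrow>\<^sub>L 'b::real_normed_vector"
  shows "subspace (closure (range T))"
proof (rule subspace_closure, rule linear_subspace_image)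
  show "linear T"
    by (rule bounded_linear.linear[OF blinfun.bounded_linear_right])
qed (rule subspace_UNIV)

section \<open>The semi-inner product of a positive operator\<close>

lemma A_inner_simps:
  "A_inner A (x + y) z = A_inner A x z + A_inner A y z"
  "A_inner A x (y + z) = A_inner A x y + A_inner A x z"
  "A_inner A (x - y) z = A_inner A x z - A_inner A y z"
  "A_inner A x (y - z) = A_inner A x y - A_inner A x z"
  "A_inner A (r *\<^sub>R x) z = r * A_inner A x z"
  "A_inner A x (r *\<^sub>R z) = r * A_inner A x z"
  "A_inner A (- x) z = - A_inner A x z"
  "A_inner A x (- z) = - A_inner A x z"
  by (simp_all add: A_inner_def blinfun.bilinear_simps inner_simps)

lemma tendsto_A_inner:
  assumes "(f \<longlongrightarrow> x) F" "(g \<longlongrightarrow> y) F"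
  shows "((\<lambda>u. A_inner A (f u) (g u)) \<longlongrightarrow> A_inner A x y) F"
  unfolding A_inner_def by (intro tendsto_intros assms)

lemma tendsto_A_norm:
  assumes "(f \<longlongrightarrow> x) F"
  shows "((\<lambda>u. A_norm A (f u)) \<longlongrightarrow> A_norm A x) F"
  unfolding A_norm_def by (intro tendsto_real_sqrt tendsto_A_inner assms)

lemma approx_orthogonalD:
  assumes "approx_orthogonal \<epsilon> A T S"
  shows "(A_opnorm A T)\<^sup>2 - 2 * \<epsilon> * A_opnorm A T * A_opnorm A (t *\<^sub>R S) \<le> (A_opnorm A (T + t *\<^sub>R S))\<^sup>2"
  using assms unfolding approx_orthogonal_def by blast

context
  fixes A :: "'a::real_inner \<Rightarrow>\<^sub>L 'a"
  assumes pos: "positive_op A"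
begin

lemma A_inner_sym: "A_inner A x y = A_inner A y x"
  using pos unfolding positive_op_def A_inner_def by (metis inner_commute)

lemma A_inner_nonneg: "0 \<le> A_inner A x x"
  using pos unfolding positive_op_def A_inner_def by blast

lemma A_norm_nonneg [simp]: "0 \<le> A_norm A x"
  by (simp add: A_norm_def A_inner_nonneg)

lemma A_norm_sq: "(A_norm A x)\<^sup>2 = A_inner A x x"
  by (simp add: A_norm_def A_inner_nonneg)

lemma A_norm_scaleR: "A_norm A (r *\<^sub>R x) = \<bar>r\<bar> * A_norm A x"
  by (simp add: A_norm_def A_inner_simps real_sqrt_mult mult.assoc [symmetric])

lemma A_norm_minus: "A_norm A (- x) = A_norm A x"
  using A_norm_scaleR[of "-1" x] by simp

lemma A_norm_add_sq:
  "(A_norm A (x + y))\<^sup>2 = (A_norm A x)\<^sup>2 + 2 * A_inner A x y + (A_norm A y)\<^sup>2"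
  unfolding A_norm_sq by (simp add: A_inner_simps A_inner_sym[of y x])

text \<open>The quadratic \<open>t \<mapsto> A_inner A (x + t *\<^sub>R y) (x + t *\<^sub>R
  y)\<close> is nonnegative. The form may be degenerate, so evaluation at its minimiser is possible
  only when \<open>A_inner A y y\<close> is nonzero.\<close>

lemma A_Cauchy_Schwarz: "\<bar>A_inner A x y\<bar> \<le> A_norm A x * A_norm A y"
proof -
  have q: "0 \<le> A_inner A x x + 2 * t * A_inner A x y + t\<^sup>2 * A_inner A y y" for t
    using A_inner_nonneg[of "x + t *\<^sub>R y"]
    by (simp add: A_inner_simps A_inner_sym[of y x] power2_eq_square algebra_simps)
  have "(A_inner A x y)\<^sup>2 \<le> A_inner A x x * A_inner A y y"
  proof (cases "A_inner A y y = 0")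
    case True
    have "A_inner A x y = 0"
    proof (rule ccontr)
      assume "A_inner A x y \<noteq> 0"
      \<comment> \<open>For null \<open>y\<close> the quadratic is affine in \<open>t\<close>; a
        nonzero slope would let it reach the value -1.\<close>
      then have "2 * (- (A_inner A x x + 1) / (2 * A_inner A x y)) * A_inner A x y
          = - (A_inner A x x + 1)"
        by simp
      with q[of "- (A_inner A x x + 1) / (2 * A_inner A x y)"] True show False
        by simp
    qed
    with True show ?thesis by simp
  next
    case False
    with A_inner_nonneg[of y] have "0 < A_inner A y y" by simp
    with q[of "- A_inner A x y / A_inner A y y"] show ?thesis
      by (simp add: field_simps power2_eq_square)
  qed
  then have "sqrt ((A_inner A x y)\<^sup>2) \<le> sqrt (A_inner A x x * A_inner A y y)"
    by (rule real_sqrt_le_mono)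
  then show ?thesis
    by (simp add: A_norm_def real_sqrt_mult)
qed

lemma A_norm_triangle: "A_norm A (x + y) \<le> A_norm A x + A_norm A y"
proof (rule power2_le_imp_le)
  show "(A_norm A (x + y))\<^sup>2 \<le> (A_norm A x + A_norm A y)\<^sup>2"
    using A_Cauchy_Schwarz[of x y] by (simp add: A_norm_add_sq power2_sum)
qed simp

text \<open>Triangle inequality in both directions. It permits replacing a vector by another one
  that differs from it by a null vector.\<close>

lemma A_norm_add_null:
  assumes "A_norm A d = 0"
  shows "A_norm A (x + d) = A_norm A x"
  using A_norm_triangle[of x d] A_norm_triangle[of "x + d" "- d"] A_norm_minus[of d] assms
  by simp

text \<open>If the seminorm vanished identically, Cauchy-Schwarz for \<open>x\<close> and
  \<open>A x\<close> would give \<open>A x \<bullet> A x = 0\<close> for all \<open>x\<close>. The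
  vector found makes the supremum in \<open>A_opnorm\<close> range over a nonempty set.\<close>

lemma A_norm_unit_exists:
  assumes "A \<noteq> 0"
  obtains x where "A_norm A x = 1"
proof -
  have "\<exists>y. A_norm A y \<noteq> 0"
  proof (rule ccontr)
    assume "\<not> (\<exists>y. A_norm A y \<noteq> 0)"
    then have "A_inner A x (A x) = 0" for x
      using A_Cauchy_Schwarz[of x "A x"] by simp
    then have "A x = 0" for x
      by (simp add: A_inner_def)
    with assms show False
      by (metis blinfun_eqI zero_blinfun.rep_eq)
  qed
  then obtain y where "A_norm A y \<noteq> 0" ..
  then have "A_norm A ((1 / A_norm A y) *\<^sub>R y) = 1"
    by (simp add: A_norm_scaleR)
  then show ?thesis by (rule that)
qed

section \<open>The operator seminorm\<close>

lemma A_opnorm_upper_unit: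
  assumes "T \<in> A_bounded_ops A" "A_norm A x = 1"
  shows "A_norm A (T x) \<le> A_opnorm A T"
proof -
  obtain c where "\<And>x. A_norm A (T x) \<le> c * A_norm A x"
    using assms(1) unfolding A_bounded_ops_def by blast
  then have "bdd_above ((\<lambda>x. A_norm A (T x)) ` {x. A_norm A x = 1})"
    by (intro bdd_aboveI[of _ c]) (metis (mono_tags, lifting) imageE mem_Collect_eq mult.right_neutral)
  then show ?thesis
    unfolding A_opnorm_def using assms(2) by (intro cSUP_upper) auto
qed

lemma A_norm_null_image:
  assumes "T \<in> A_bounded_ops A" "A_norm A x = 0"
  shows "A_norm A (T x) = 0"
proof -
  obtain c where "\<And>x. A_norm A (T x) \<le> c * A_norm A x"
    using assms(1) unfolding A_bounded_ops_def by blast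
  from this[of x] assms(2) show ?thesis
    by (simp add: order_antisym)
qed

lemma A_opnorm_upper:
  assumes "T \<in> A_bounded_ops A"
  shows "A_norm A (T x) \<le> A_opnorm A T * A_norm A x"
proof (cases "A_norm A x = 0")
  case True
  then show ?thesis using A_norm_null_image[OF assms True] by simp
next
  case False
  then have "0 < A_norm A x"
    using A_norm_nonneg[of x] by linarith
  moreover have "A_norm A (T ((1 / A_norm A x) *\<^sub>R x)) \<le> A_opnorm A T"
    using False by (intro A_opnorm_upper_unit assms) (simp add: A_norm_scaleR)
  ultimately show ?thesis
    by (simp add: blinfun.scaleR_right A_norm_scaleR field_simps)
qed

lemma A_opnorm_nonneg:
  assumes "A \<noteq> 0" "T \<in> A_bounded_ops A"
  shows "0 \<le> A_opnorm A T"
proof -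
  obtain x where "A_norm A x = 1"
    using A_norm_unit_exists[OF assms(1)] .
  then show ?thesis
    using A_opnorm_upper_unit[OF assms(2)] order_trans[OF A_norm_nonneg] by blast
qed

lemma A_bounded_ops_scaleR:
  assumes "S \<in> A_bounded_ops A"
  shows "r *\<^sub>R S \<in> A_bounded_ops A"
proof -
  obtain c where c: "c > 0" "\<And>x. A_norm A (S x) \<le> c * A_norm A x"
    using assms unfolding A_bounded_ops_def by blast
  have "A_norm A ((r *\<^sub>R S) x) \<le> (\<bar>r\<bar> * c + 1) * A_norm A x" for x
  proof -
    have "A_norm A ((r *\<^sub>R S) x) = \<bar>r\<bar> * A_norm A (S x)"
      by (simp add: blinfun.scaleR_left A_norm_scaleR)
    also have "\<dots> \<le> \<bar>r\<bar> * (c * A_norm A x)"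
      by (intro mult_left_mono c(2)) simp
    also have "\<dots> \<le> (\<bar>r\<bar> * c + 1) * A_norm A x"
      by (simp add: distrib_right mult.assoc)
    finally show ?thesis .
  qed
  moreover have "0 < \<bar>r\<bar> * c + 1"
    using c(1) by (simp add: add_nonneg_pos)
  ultimately show ?thesis
    unfolding A_bounded_ops_def by blast
qed

lemma A_bounded_ops_add:
  assumes "T \<in> A_bounded_ops A" "S \<in> A_bounded_ops A"
  shows "T + S \<in> A_bounded_ops A"
proof -
  obtain c where c: "c > 0" "\<And>x. A_norm A (T x) \<le> c * A_norm A x"
    using assms unfolding A_bounded_ops_def by blast
  obtain d where d: "d > 0" "\<And>x. A_norm A (S x) \<le> d * A_norm A x"
    using assms unfolding A_bounded_ops_def by blast
  have "A_norm A ((T + S) x) \<le> (c + d) * A_norm A x" for x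
    using A_norm_triangle[of "T x" "S x"] c(2)[of x] d(2)[of x]
    by (simp add: blinfun.add_left algebra_simps)
  then show ?thesis
    unfolding A_bounded_ops_def using c(1) d(1) by (auto intro: exI[of _ "c + d"])
qed

lemma A_opnorm_scaleR:
  assumes "A \<noteq> 0" "S \<in> A_bounded_ops A"
  shows "A_opnorm A (r *\<^sub>R S) = \<bar>r\<bar> * A_opnorm A S"
proof -
  \<comment> \<open>Stated for all \<open>r\<close> and \<open>B\<close> so that it also yields the
    reverse inequality, by scaling \<open>r *\<^sub>R S\<close> back with
    \<open>1 / r\<close>.\<close>
  have le: "A_opnorm A (r *\<^sub>R B) \<le> \<bar>r\<bar> * A_opnorm A B" if B: "B \<in> A_bounded_ops A" for r B
  proof -
    obtain x where x: "A_norm A x = 1"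
      using A_norm_unit_exists[OF assms(1)] .
    show ?thesis
      unfolding A_opnorm_def[of A "r *\<^sub>R B"]
    proof (rule cSUP_least)
      fix x assume "x \<in> {x. A_norm A x = 1}"
      with A_opnorm_upper_unit[OF B, of x]
      show "A_norm A ((r *\<^sub>R B) x) \<le> \<bar>r\<bar> * A_opnorm A B"
        by (simp add: blinfun.scaleR_left A_norm_scaleR mult_left_mono)
    qed (use x in auto)
  qed
  show ?thesis
  proof (cases "r = 0")
    case True
    then show ?thesis
      using le[OF assms(2), of 0] A_opnorm_nonneg[OF assms(1) A_bounded_ops_scaleR[OF assms(2)], of 0]
      by simp
  next
    case False
    with le[OF A_bounded_ops_scaleR[OF assms(2), of r], of "1 / r"]
    have "\<bar>r\<bar> * A_opnorm A S \<le> A_opnorm A (r *\<^sub>R S)"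
      by (simp add: field_simps)
    with le[OF assms(2), of r] show ?thesis by simp
  qed
qed

text \<open>The scalar ranges over both signs, so \<open>t\<close> can be replaced by
  \<open>- t\<close>. This turns lower bounds for the inner product into upper ones.\<close>

lemma approx_orthogonal_minus:
  assumes "A \<noteq> 0" "S \<in> A_bounded_ops A" "approx_orthogonal \<epsilon> A T S"
  shows "approx_orthogonal \<epsilon> A T (- S)"
  unfolding approx_orthogonal_def
proof
  fix t :: real
  show "(A_opnorm A (T + t *\<^sub>R - S))\<^sup>2
      \<ge> (A_opnorm A T)\<^sup>2 - 2 * \<epsilon> * A_opnorm A T * A_opnorm A (t *\<^sub>R - S)"
    using approx_orthogonalD[OF assms(3), of "- t"] by simp
qed

text \<open>The error is measured on squares because approximate orthogonality compares squared
  seminorms. If the target is negative, any unit vector serves; otherwise its square root lies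
  strictly below the supremum.\<close>

lemma A_opnorm_near_attained:
  assumes "A \<noteq> 0" "T \<in> A_bounded_ops A" "0 < e"
  obtains x where "A_norm A x = 1" "(A_opnorm A T)\<^sup>2 - e \<le> (A_norm A (T x))\<^sup>2"
proof -
  obtain x0 where x0: "A_norm A x0 = 1"
    using A_norm_unit_exists[OF assms(1)] .
  show ?thesis
  proof (cases "(A_opnorm A T)\<^sup>2 - e < 0")
    case True
    with x0 show ?thesis
      using that[of x0] by (simp add: order_trans[OF less_imp_le zero_le_power2])
  next
    case False
    have "sqrt ((A_opnorm A T)\<^sup>2 - e) < sqrt ((A_opnorm A T)\<^sup>2)"
      using assms(3) by (intro real_sqrt_less_mono) simp
    then have "sqrt ((A_opnorm A T)\<^sup>2 - e) < A_opnorm A T"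
      using A_opnorm_nonneg[OF assms(1,2)] by simp
    then have "\<exists>x. A_norm A x = 1 \<and> sqrt ((A_opnorm A T)\<^sup>2 - e) < A_norm A (T x)"
      unfolding A_opnorm_def[of A T]
      using less_cSupD[of "(\<lambda>x. A_norm A (T x)) ` {x. A_norm A x = 1}"] x0 by fastforce
    then obtain x where "A_norm A x = 1" "sqrt ((A_opnorm A T)\<^sup>2 - e) < A_norm A (T x)"
      by blast
    moreover from this(2) have "(A_opnorm A T)\<^sup>2 - e \<le> (A_norm A (T x))\<^sup>2"
      by (simp add: sqrt_le_D)
    ultimately show ?thesis by (intro that)
  qed
qed

text \<open>Intermediate value theorem on the segment from \<open>x\<close> to \<open>y\<close>,
  followed by normalisation. The sign condition on \<open>A_inner A x y\<close> keeps null vectors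
  off the segment.\<close>

lemma A_opnorm_attained_segment:
  fixes S :: "'a \<Rightarrow>\<^sub>L 'a"
  assumes T: "T \<in> A_bounded_ops A"
    and x: "A_norm A x = 1" "A_norm A (T x) = A_opnorm A T"
    and y: "A_norm A y = 1" "A_norm A (T y) = A_opnorm A T"
    and xy: "A_inner A x y \<ge> 0"
    and S: "A_inner A (T x) (S x) \<ge> k" "A_inner A (T y) (S y) \<le> k"
  shows "\<exists>z. A_norm A z = 1 \<and> A_norm A (T z) = A_opnorm A T \<and> A_inner A (T z) (S z) = k"
proof -
  define c where "c = A_opnorm A T"
  have xx: "A_inner A x x = 1" "A_inner A (T x) (T x) = c\<^sup>2"
    and yy: "A_inner A y y = 1" "A_inner A (T y) (T y) = c\<^sup>2"
    using x y unfolding A_norm_sq [symmetric] c_def by simp_all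
  have le: "A_inner A (T v) (T v) \<le> c\<^sup>2 * A_inner A v v" for v
    using power_mono[OF A_opnorm_upper[OF T, of v], of 2]
    by (simp add: c_def power_mult_distrib A_norm_sq)
  \<comment> \<open>The form \<open>c\<^sup>2\<langle>v,v\<rangle>\<^sub>A - \<langle>Tv,Tv\<rangle>\<^sub>A\<close> is positive semidefinite and vanishes at \<open>x\<close> and \<open>y\<close>,
    hence at every combination of them.\<close>
  have cross: "A_inner A (T x) (T y) = c\<^sup>2 * A_inner A x y"
    using le[of "x + y"] le[of "x - y"]
    by (simp add: blinfun.bilinear_simps A_inner_simps A_inner_sym[of y x]
        A_inner_sym[of "T y" "T x"] xx yy algebra_simps)
  define p where "p u = (1 - u) *\<^sub>R x + u *\<^sub>R y" for u :: real
  have Tp: "A_inner A (T (p u)) (T (p u)) = c\<^sup>2 * A_inner A (p u) (p u)" for u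
    unfolding p_def
    by (simp add: blinfun.bilinear_simps A_inner_simps A_inner_sym[of y x]
        A_inner_sym[of "T y" "T x"] xx yy cross algebra_simps)
  have pp: "0 < A_inner A (p u) (p u)" if "0 \<le> u" "u \<le> 1" for u
  proof -
    have "A_inner A (p u) (p u) = (1 - u)\<^sup>2 + 2 * ((1 - u) * u * A_inner A x y) + u\<^sup>2"
      unfolding p_def
      by (simp add: A_inner_simps A_inner_sym[of y x] xx yy power2_eq_square algebra_simps)
    moreover have "0 \<le> (1 - u) * u * A_inner A x y"
      using that xy by simp
    moreover have "0 < (1 - u)\<^sup>2 + u\<^sup>2"
      by (cases "u = 0") (simp_all add: add_nonneg_pos)
    ultimately show ?thesis by linarith
  qed
  \<comment> \<open>Weighting \<open>k\<close> by \<open>A_inner A (p u) (p u)\<close> avoids a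
    quotient: a zero of \<open>h\<close> gives the value \<open>k\<close> once \<open>p u\<close> is
    normalised.\<close>
  define h where "h u = A_inner A (T (p u)) (S (p u)) - k * A_inner A (p u) (p u)" for u
  have "continuous_on {0..1} h"
    unfolding h_def A_inner_def p_def by (intro continuous_intros)
  moreover have "h 1 \<le> 0" "0 \<le> h 0"
    using S by (simp_all add: h_def p_def xx yy)
  ultimately obtain u where u: "0 \<le> u" "u \<le> 1" "h u = 0"
    using IVT2'[of h 1 0 0] by auto
  define n where "n = A_norm A (p u)"
  have n: "n\<^sup>2 = A_inner A (p u) (p u)" "0 < n"
    using pp[OF u(1,2)] unfolding n_def by (simp_all add: A_norm_sq A_norm_def)
  define z where "z = (1 / n) *\<^sub>R p u"
  have "A_norm A z = 1"
    using n(2) by (simp add: z_def A_norm_scaleR n_def [symmetric])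
  moreover have "A_norm A (T z) = c"
  proof (rule power2_eq_imp_eq)
    show "(A_norm A (T z))\<^sup>2 = c\<^sup>2"
      using n pp[OF u(1,2)] unfolding A_norm_sq z_def
      by (simp add: blinfun.bilinear_simps A_inner_simps Tp power2_eq_square field_simps)
    show "0 \<le> c"
      unfolding c_def using x(2) A_norm_nonneg by metis
  qed simp
  moreover have "A_inner A (T z) (S z) = k"
    using n pp[OF u(1,2)] u(3) unfolding z_def h_def
    by (simp add: blinfun.bilinear_simps A_inner_simps power2_eq_square field_simps)
  ultimately show ?thesis
    unfolding c_def by blast
qed

section \<open>Consequences of the boundedness of the ball\<close>

text \<open>Scale to the unit sphere of the seminorm. A nonzero null vector in the subspace would
  put a whole line into the bounded set.\<close>

lemma A_norm_coercive:
  assumes "bounded (A_ball A \<inter> closure (range A))"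
  shows "\<exists>K>0. \<forall>x\<in>closure (range A). norm x \<le> K * A_norm A x"
proof -
  have sub: "subspace (closure (range A))"
    by (rule subspace_closure_range)
  obtain K where "K > 0 \<and> (\<forall>x\<in>A_ball A \<inter> closure (range A). norm x \<le> K)"
    using assms unfolding bounded_pos ..
  then have K: "K > 0" "\<And>x. x \<in> A_ball A \<inter> closure (range A) \<Longrightarrow> norm x \<le> K"
    by simp_all
  have "norm x \<le> K * A_norm A x" if x: "x \<in> closure (range A)" for x
  proof (cases "A_norm A x = 0")
    case True
    then have "r *\<^sub>R x \<in> A_ball A \<inter> closure (range A)" for r
      using x sub by (simp add: A_ball_def A_norm_scaleR subspace_scale)
    from K(2)[OF this] have b: "\<bar>r\<bar> * norm x \<le> K" for r
      by simp
    have "norm x = 0"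
    proof (rule ccontr)
      assume "norm x \<noteq> 0"
      then show False using b[of "(K + 1) / norm x"] K(1) by simp
    qed
    then show ?thesis using K(1) by simp
  next
    case False
    then have p: "0 < A_norm A x"
      using A_norm_nonneg[of x] by linarith
    then have "(1 / A_norm A x) *\<^sub>R x \<in> A_ball A \<inter> closure (range A)"
      using x sub by (simp add: A_ball_def A_norm_scaleR subspace_scale)
    from K(2)[OF this] p show ?thesis
      by (simp add: field_simps)
  qed
  with K(1) show ?thesis by (intro exI[of _ K]) simp
qed

end

text \<open>
  The component of \<open>x\<close> in \<open>closure (range A)\<close> is the fixed point of \<open>p \<mapsto> p + s A(x - p)\<close>, a
  contraction of that subspace for small \<open>s > 0\<close> by coercivity.
\<close>

lemma closed_range_component:
  fixes A :: "'a::{real_inner, complete_space} \<Rightarrow>\<^sub>L 'a"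
  assumes pos: "positive_op A"
    and bdd: "bounded (A_ball A \<inter> closure (range A))"
  obtains p where "p \<in> closure (range A)" "A p = A x"
proof -
  define V where "V = closure (range A)"
  have sub: "subspace V" unfolding V_def
    by (rule subspace_closure_range)
  have rV: "A v \<in> V" for v
    unfolding V_def by (rule subsetD[OF closure_subset rangeI])
  obtain K where "K > 0 \<and> (\<forall>x\<in>V. norm x \<le> K * A_norm A x)"
    using A_norm_coercive[OF pos bdd, folded V_def] ..
  then have K: "K > 0" "\<And>x. x \<in> V \<Longrightarrow> norm x \<le> K * A_norm A x"
    by simp_all
  \<comment> \<open>On \<open>V\<close> the form \<open>A v \<bullet> v\<close> is at least
    \<open>(norm v)\<^sup>2 / K\<^sup>2\<close>, and \<open>M\<close> bounds the norm of
    \<open>A\<close>. The chosen \<open>s\<close> minimises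
    \<open>1 - 2 * s / K\<^sup>2 + s\<^sup>2 * M\<^sup>2\<close>, with minimum \<open>q\<close>; the
    second entry of the maximum makes \<open>q\<close> nonnegative.\<close>
  define M where "M = max (norm A) (1 / K\<^sup>2)"
  have M: "0 < M" "norm A \<le> M" "1 / K\<^sup>2 \<le> M"
    using K(1) by (auto simp: M_def less_max_iff_disj)
  define s where "s = 1 / (K\<^sup>2 * M\<^sup>2)"
  define q where "q = 1 - 1 / (K\<^sup>2 * M)\<^sup>2"
  have s: "0 < s" "s \<noteq> 0" using K(1) M(1) by (simp_all add: s_def)
  have q: "0 \<le> q" "q < 1"
  proof -
    have "1 \<le> K\<^sup>2 * M" using M(3) K(1) by (simp add: field_simps)
    then have "1 \<le> (K\<^sup>2 * M)\<^sup>2" by (rule one_le_power)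
    then show "0 \<le> q" unfolding q_def by (simp add: field_simps)
    show "q < 1" unfolding q_def using K(1) M(1) by simp
  qed
  define f where "f p = p + s *\<^sub>R A (x - p)" for p
  have contr: "norm (v - s *\<^sub>R A v) \<le> sqrt q * norm v" if v: "v \<in> V" for v
  proof -
    have "(norm v)\<^sup>2 \<le> K\<^sup>2 * (A v \<bullet> v)"
      using power_mono[OF K(2)[OF v], of 2]
      by (simp add: power_mult_distrib A_norm_sq[OF pos] A_inner_def)
    then have 1: "(norm v)\<^sup>2 / K\<^sup>2 \<le> A v \<bullet> v"
      using K(1) by (simp add: field_simps)
    have "norm (A v) \<le> M * norm v"
      using norm_blinfun[of A v] mult_right_mono[OF M(2) norm_ge_zero[of v]] by linarith
    then have 2: "(norm (A v))\<^sup>2 \<le> M\<^sup>2 * (norm v)\<^sup>2"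
      using power_mono[of "norm (A v)" "M * norm v" 2] by (simp add: power_mult_distrib)
    have "(norm (v - s *\<^sub>R A v))\<^sup>2 = (norm v)\<^sup>2 - 2 * s * (A v \<bullet> v) + s\<^sup>2 * (norm (A v))\<^sup>2"
      unfolding power2_norm_eq_inner
      by (simp add: inner_simps inner_commute power2_eq_square algebra_simps)
    also have "\<dots> \<le> (norm v)\<^sup>2 - 2 * s * ((norm v)\<^sup>2 / K\<^sup>2) + s\<^sup>2 * (M\<^sup>2 * (norm v)\<^sup>2)"
      using s(1) by (intro add_mono diff_mono mult_left_mono 1 2) simp_all
    also have "\<dots> = q * (norm v)\<^sup>2"
      using K(1) M(1) unfolding s_def q_def by (simp add: field_simps power2_eq_square)
    finally have "sqrt ((norm (v - s *\<^sub>R A v))\<^sup>2) \<le> sqrt (q * (norm v)\<^sup>2)"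
      by (rule real_sqrt_le_mono)
    then show ?thesis by (simp add: real_sqrt_mult)
  qed
  have "\<exists>!p. p \<in> V \<and> f p = p"
  proof (rule Banach_fix)
    show "complete V" unfolding V_def by (simp add: complete_eq_closed)
    show "V \<noteq> {}" using rV by blast
    show "0 \<le> sqrt q" "sqrt q < 1" using q by simp_all
    show "f ` V \<subseteq> V"
      unfolding f_def using sub rV by (auto intro: subspace_add subspace_scale)
    fix y z assume "y \<in> V" "z \<in> V"
    then have "y - z \<in> V" using sub by (simp add: subspace_diff)
    moreover have "f y - f z = (y - z) - s *\<^sub>R A (y - z)"
      by (simp add: f_def blinfun.bilinear_simps algebra_simps)
    ultimately show "dist (f y) (f z) \<le> sqrt q * dist y z"
      unfolding dist_norm using contr by metis
  qed
  then obtain p where p: "p \<in> V" "f p = p" by blast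
  then have "A p = A x"
    using s(2) by (simp add: f_def blinfun.diff_right)
  with p(1) show ?thesis unfolding V_def by (rule that)
qed

section \<open>Maximising sequences\<close>

text \<open>\<open>T (X m + X n)\<close> approaches \<open>2 *\<^sub>R y\<close>, which forces the
  seminorm of \<open>X m + X n\<close> towards 2. The parallelogram law then makes
  \<open>X m - X n\<close> small in the seminorm, and coercivity on \<open>V\<close> makes it small
  in norm.\<close>

lemma A_maximising_Cauchy:
  assumes pos: "positive_op A" and T: "T \<in> A_bounded_ops A" and c: "0 < A_opnorm A T"
    and V: "subspace V" "\<And>x. x \<in> V \<Longrightarrow> norm x \<le> K * A_norm A x"
    and K: "K > 0"
    and X: "\<And>n::nat. X n \<in> V" "\<And>n. A_norm A (X n) = 1"
    and lim: "(\<lambda>n. T (X n)) \<longlonglongrightarrow> y"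
    and y: "A_norm A y = A_opnorm A T"
  shows "Cauchy X"
proof (rule CauchyI)
  fix e :: real assume e: "0 < e"
  define c where "c = A_opnorm A T"
  have c0: "0 < c" using c by (simp add: c_def)
  \<comment> \<open>The parallelogram law will bound the squared seminorm of the difference by
    \<open>4 - (2 - d)\<^sup>2\<close>, at most \<open>4 * d\<close>, hence below
    \<open>(e / K)\<^sup>2\<close>. The cap 1 keeps \<open>2 - d\<close> positive for
    squaring.\<close>
  define d where "d = min 1 ((e / K)\<^sup>2 / 8)"
  have d: "0 < d" "d \<le> 1" "8 * d \<le> (e / K)\<^sup>2"
    using e K by (auto simp: d_def)
  have "(\<lambda>n. A_norm A (T (X n) - y)) \<longlonglongrightarrow> A_norm A (y - y)"
    by (intro tendsto_A_norm tendsto_intros lim)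
  then have "(\<lambda>n. A_norm A (T (X n) - y)) \<longlonglongrightarrow> 0"
    by (simp add: A_norm_def A_inner_def)
  moreover have "0 < c * d / 2"
    using c0 d(1) by simp
  ultimately have "eventually (\<lambda>n. A_norm A (T (X n) - y) < c * d / 2) sequentially"
    by (rule order_tendstoD(2))
  then obtain N where N: "\<And>n. n \<ge> N \<Longrightarrow> A_norm A (T (X n) - y) < c * d / 2"
    unfolding eventually_sequentially by blast
  show "\<exists>M. \<forall>m\<ge>M. \<forall>n\<ge>M. norm (X m - X n) < e"
  proof (intro exI allI impI)
    fix m n assume mn: "m \<ge> N" "n \<ge> N"
    have "2 * c = A_norm A (2 *\<^sub>R y)"
      by (simp add: A_norm_scaleR[OF pos] y c_def)
    also have "2 *\<^sub>R y = T (X m + X n) + (- (T (X m) - y) + - (T (X n) - y))"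
      by (simp add: blinfun.add_right scaleR_2)
    also have "A_norm A \<dots> \<le> A_norm A (T (X m + X n)) +
        (A_norm A (- (T (X m) - y)) + A_norm A (- (T (X n) - y)))"
      by (intro order_trans[OF A_norm_triangle[OF pos]] add_left_mono A_norm_triangle pos)
    also have "\<dots> < c * A_norm A (X m + X n) + c * d"
      unfolding A_norm_minus[OF pos]
      using A_opnorm_upper[OF pos T, of "X m + X n"] N[OF mn(1)] N[OF mn(2)]
      by (simp add: c_def)
    finally have "c * 2 < c * (A_norm A (X m + X n) + d)"
      by (simp add: algebra_simps)
    then have "2 - d < A_norm A (X m + X n)"
      using c0 by simp
    then have "(2 - d)\<^sup>2 < (A_norm A (X m + X n))\<^sup>2"
      using d by (intro power_strict_mono) auto
    moreover have "4 - 4 * d \<le> (2 - d)\<^sup>2"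
      by (simp add: power2_diff)
    moreover have "(A_norm A (X m + X n))\<^sup>2 + (A_norm A (X m - X n))\<^sup>2 = 4"
      using A_norm_add_sq[OF pos, of "X m" "X n"] A_norm_add_sq[OF pos, of "X m" "- X n"]
      by (simp add: X(2) A_norm_minus[OF pos] A_inner_simps)
    ultimately have "(A_norm A (X m - X n))\<^sup>2 < (e / K)\<^sup>2"
      using d by linarith
    then have "A_norm A (X m - X n) < e / K"
      by (rule power2_less_imp_less) (use e K in simp)
    then have "K * A_norm A (X m - X n) < e"
      using K by (simp add: field_simps)
    with V(2)[OF subspace_diff[OF V(1) X(1)[of m] X(1)[of n]]]
    show "norm (X m - X n) < e" by linarith
  qed
qed

text \<open>Compactness is defined on the unit ball, so the sequence is scaled into it by
  \<open>1 / K\<close> and the limit is scaled back.\<close>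

lemma compact_op_image_subseq:
  assumes "compact_op T" and "\<And>n::nat. norm (X n) \<le> K" and "K > 0"
  obtains r y where "strict_mono (r :: nat \<Rightarrow> nat)" "(\<lambda>n. T (X (r n))) \<longlonglongrightarrow> y"
proof -
  have "T ((1 / K) *\<^sub>R X n) \<in> closure (T ` cball 0 1)" for n
    using assms(2)[of n] assms(3) by (intro subsetD[OF closure_subset] imageI) simp
  moreover have "seq_compact (closure (T ` cball 0 1))"
    using assms(1) by (simp add: compact_op_def compact_eq_seq_compact_metric)
  ultimately obtain l r where r: "strict_mono (r :: nat \<Rightarrow> nat)"
      "((\<lambda>n. T ((1 / K) *\<^sub>R X n)) \<circ> r) \<longlonglongrightarrow> l"
    unfolding seq_compact_def by meson
  have "(\<lambda>n. K *\<^sub>R T ((1 / K) *\<^sub>R X (r n))) \<longlonglongrightarrow> K *\<^sub>R l"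
    using r(2) by (intro tendsto_intros) (simp add: o_def)
  then have "(\<lambda>n. T (X (r n))) \<longlonglongrightarrow> K *\<^sub>R l"
    using assms(3) by (simp add: blinfun.scaleR_right)
  with r(1) show ?thesis by (rule that)
qed

text \<open>First-order perturbation: near-maximisers of \<open>T + t *\<^sub>R S\<close> for
  \<open>t\<close> decreasing to 0 converge along a subsequence, and the coefficient of
  \<open>t\<close> in the orthogonality inequality survives in the limit.\<close>

lemma A_opnorm_attained_lower_bound:
  fixes A T S :: "'a::{real_inner, complete_space} \<Rightarrow>\<^sub>L 'a"
  assumes pos: "positive_op A" and A0: "A \<noteq> 0"
    and bdd: "bounded (A_ball A \<inter> closure (range A))"
    and T: "T \<in> A_bounded_ops A" and S: "S \<in> A_bounded_ops A"
    and comp: "compact_op T" and c: "0 < A_opnorm A T"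
    and eps: "0 \<le> \<epsilon>"
    and orth: "approx_orthogonal \<epsilon> A T S"
  obtains x where "A_norm A x = 1" "A_norm A (T x) = A_opnorm A T"
    "- (\<epsilon> * A_opnorm A T * A_opnorm A S) \<le> A_inner A (T x) (S x)"
proof -
  define c where "c = A_opnorm A T"
  define s where "s = A_opnorm A S"
  have s0: "0 \<le> s" unfolding s_def by (rule A_opnorm_nonneg[OF pos A0 S])
  have c0: "0 < c" using c by (simp add: c_def)
  define V where "V = closure (range A)"
  have sub: "subspace V" unfolding V_def
    by (rule subspace_closure_range)
  obtain K where "K > 0 \<and> (\<forall>x\<in>V. norm x \<le> K * A_norm A x)"
    using A_norm_coercive[OF pos bdd, folded V_def] ..
  then have K: "K > 0" "\<And>x. x \<in> V \<Longrightarrow> norm x \<le> K * A_norm A x"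
    by simp_all
  define t :: "nat \<Rightarrow> real" where "t n = inverse (real (Suc n))" for n
  have t0: "0 < t n" for n by (simp add: t_def)
  have tlim: "t \<longlonglongrightarrow> 0" unfolding t_def by (rule LIMSEQ_inverse_real_of_nat)
  \<comment> \<open>The maximisation error \<open>(t n)\<^sup>2\<close> is of smaller order than
    \<open>t n\<close>, so it disappears after division by \<open>t n\<close>.\<close>
  have "\<exists>x. x \<in> V \<and> A_norm A x = 1 \<and>
      c\<^sup>2 - 2 * \<epsilon> * c * (t n * s) - (t n)\<^sup>2 \<le> (A_norm A (T x + t n *\<^sub>R S x))\<^sup>2" for n
  proof -
    define B where "B = T + t n *\<^sub>R S"
    have B: "B \<in> A_bounded_ops A"
      unfolding B_def by (intro A_bounded_ops_add A_bounded_ops_scaleR pos T S)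
    obtain w where w: "A_norm A w = 1" "(A_opnorm A B)\<^sup>2 - (t n)\<^sup>2 \<le> (A_norm A (B w))\<^sup>2"
      using A_opnorm_near_attained[OF pos A0 B, of "(t n)\<^sup>2"] t0[of n] by auto
    \<comment> \<open>Moving \<open>w\<close> into \<open>V\<close> changes it by a null vector,
      which \<open>B\<close> maps to a null vector; both seminorms are kept and coercivity becomes
      available.\<close>
    obtain p where p: "p \<in> V" "A p = A w"
      by (rule closed_range_component[OF pos bdd, folded V_def])
    have null: "A_norm A (p - w) = 0"
      by (simp add: A_norm_def A_inner_def blinfun.diff_right p(2))
    have "A_norm A p = A_norm A w"
      using A_norm_add_null[OF pos null, of w] by simp
    moreover have "A_norm A (B p) = A_norm A (B w)"
      using A_norm_add_null[OF pos A_norm_null_image[OF pos B null], of "B w"]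
      by (simp add: blinfun.diff_right)
    moreover have "c\<^sup>2 - 2 * \<epsilon> * c * (t n * s) \<le> (A_opnorm A B)\<^sup>2"
      using approx_orthogonalD[OF orth, of "t n"] t0[of n]
      by (simp add: A_opnorm_scaleR[OF pos A0 S] B_def c_def s_def)
    ultimately show ?thesis
      using w p(1) by (auto simp: B_def blinfun.bilinear_simps intro!: exI[of _ p])
  qed
  then obtain X where X: "\<And>n. X n \<in> V" "\<And>n. A_norm A (X n) = 1"
    and near: "\<And>n. c\<^sup>2 - 2 * \<epsilon> * c * (t n * s) - (t n)\<^sup>2 \<le> (A_norm A (T (X n) + t n *\<^sub>R S (X n)))\<^sup>2"
    by metis
  have Sle: "A_norm A (S (X n)) \<le> s" and Tle: "A_norm A (T (X n)) \<le> c" for n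
    using A_opnorm_upper_unit[OF pos S X(2)] A_opnorm_upper_unit[OF pos T X(2)]
    by (simp_all add: s_def c_def)
  have expand: "c\<^sup>2 - 2 * \<epsilon> * c * (t n * s) - (t n)\<^sup>2 \<le>
      (A_norm A (T (X n)))\<^sup>2 + 2 * t n * A_inner A (T (X n)) (S (X n)) + (t n)\<^sup>2 * s\<^sup>2" for n
  proof -
    have "(t n)\<^sup>2 * (A_norm A (S (X n)))\<^sup>2 \<le> (t n)\<^sup>2 * s\<^sup>2"
      using Sle[of n] A_norm_nonneg[OF pos] by (intro mult_left_mono power_mono) auto
    with near[of n] show ?thesis
      by (simp add: A_norm_add_sq[OF pos] A_norm_scaleR[OF pos] A_inner_simps power_mult_distrib)
  qed
  \<comment> \<open>Bounding the seminorm of \<open>T (X n)\<close> by \<open>c\<close> cancels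
    \<open>c\<^sup>2\<close> in \<open>expand\<close>; what remains is divided by
    \<open>2 * t n\<close>.\<close>
  have inner_ge: "- (\<epsilon> * c * s) - t n * (1 + s\<^sup>2) / 2 \<le> A_inner A (T (X n)) (S (X n))" for n
  proof -
    have "(A_norm A (T (X n)))\<^sup>2 \<le> c\<^sup>2"
      using Tle[of n] A_norm_nonneg[OF pos] by (intro power_mono) auto
    moreover have "2 * t n * (- (\<epsilon> * c * s) - t n * (1 + s\<^sup>2) / 2)
        = - 2 * \<epsilon> * c * (t n * s) - (t n)\<^sup>2 - (t n)\<^sup>2 * s\<^sup>2"
      by (simp add: field_simps power2_eq_square)
    ultimately
    have "2 * t n * (- (\<epsilon> * c * s) - t n * (1 + s\<^sup>2) / 2) \<le> 2 * t n * A_inner A (T (X n)) (S (X n))"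
      using expand[of n] by linarith
    then show ?thesis using t0[of n] by simp
  qed
  \<comment> \<open>Here \<open>expand\<close> is used the other way: the inner product is bounded
    by \<open>c * s\<close>, so the seminorms of \<open>T (X n)\<close> are squeezed to
    \<open>c\<close>.\<close>
  have norm_ge: "c\<^sup>2 - 2 * \<epsilon> * c * (t n * s) - (t n)\<^sup>2 - 2 * t n * (c * s) - (t n)\<^sup>2 * s\<^sup>2
      \<le> (A_norm A (T (X n)))\<^sup>2" for n
  proof -
    have "A_inner A (T (X n)) (S (X n)) \<le> A_norm A (T (X n)) * A_norm A (S (X n))"
      using A_Cauchy_Schwarz[OF pos, of "T (X n)" "S (X n)"] by linarith
    also have "\<dots> \<le> c * s"
      using Tle[of n] Sle[of n] A_norm_nonneg[OF pos] c0 by (intro mult_mono) auto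
    finally have "2 * t n * A_inner A (T (X n)) (S (X n)) \<le> 2 * t n * (c * s)"
      using t0[of n] by simp
    with expand[of n] show ?thesis by linarith
  qed
  have "norm (X n) \<le> K" for n using K(2)[OF X(1)[of n]] X(2)[of n] by simp
  then obtain r y where r: "strict_mono r" and y: "(\<lambda>n. T (X (r n))) \<longlonglongrightarrow> y"
    using compact_op_image_subseq[OF comp _ K(1)] by metis
  have tr: "(\<lambda>n. t (r n)) \<longlonglongrightarrow> 0"
    using LIMSEQ_subseq_LIMSEQ[OF tlim r] by (simp add: o_def)
  have ylim: "(\<lambda>n. A_norm A (T (X (r n)))) \<longlonglongrightarrow> A_norm A y"
    by (rule tendsto_A_norm[OF y])
  have "A_norm A y \<le> c"
    by (rule LIMSEQ_le_const2[OF ylim]) (use Tle in blast)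
  moreover have "c \<le> A_norm A y"
  proof (rule power2_le_imp_le)
    show "c\<^sup>2 \<le> (A_norm A y)\<^sup>2"
    proof (rule LIMSEQ_le)
      show "(\<lambda>n. (A_norm A (T (X (r n))))\<^sup>2) \<longlonglongrightarrow> (A_norm A y)\<^sup>2"
        by (intro tendsto_intros ylim)
      have "(\<lambda>n. c\<^sup>2 - 2 * \<epsilon> * c * (t (r n) * s) - (t (r n))\<^sup>2 - 2 * t (r n) * (c * s)
          - (t (r n))\<^sup>2 * s\<^sup>2)
        \<longlonglongrightarrow> c\<^sup>2 - 2 * \<epsilon> * c * (0 * s) - 0\<^sup>2 - 2 * 0 * (c * s) - 0\<^sup>2 * s\<^sup>2"
        by (intro tendsto_intros tr)
      then show "(\<lambda>n. c\<^sup>2 - 2 * \<epsilon> * c * (t (r n) * s) - (t (r n))\<^sup>2 - 2 * t (r n) * (c * s)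
          - (t (r n))\<^sup>2 * s\<^sup>2) \<longlonglongrightarrow> c\<^sup>2"
        by simp
    qed (use norm_ge in blast)
  qed (simp add: A_norm_nonneg[OF pos])
  ultimately have yc: "A_norm A y = c" by simp
  have "Cauchy (\<lambda>n. X (r n))"
    using A_maximising_Cauchy[OF pos T c sub K(2) K(1) X(1) X(2) y yc[unfolded c_def]] .
  then obtain x where x: "(\<lambda>n. X (r n)) \<longlonglongrightarrow> x"
    using Cauchy_convergent_iff convergent_def by blast
  have Tx: "(\<lambda>n. T (X (r n))) \<longlonglongrightarrow> T x" and Sx: "(\<lambda>n. S (X (r n))) \<longlonglongrightarrow> S x"
    by (intro tendsto_intros x)+
  show ?thesis
  proof (rule that)
    show "A_norm A x = 1"
      using tendsto_A_norm[OF x, of A] by (simp add: X(2) LIMSEQ_const_iff)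
    show "A_norm A (T x) = A_opnorm A T"
      using yc LIMSEQ_unique[OF Tx y] by (simp add: c_def)
    have "- (\<epsilon> * c * s) \<le> A_inner A (T x) (S x)"
    proof (rule LIMSEQ_le)
      show "(\<lambda>n. A_inner A (T (X (r n))) (S (X (r n)))) \<longlonglongrightarrow> A_inner A (T x) (S x)"
        by (rule tendsto_A_inner[OF Tx Sx])
      have "(\<lambda>n. - (\<epsilon> * c * s) - t (r n) * (1 + s\<^sup>2) / 2) \<longlonglongrightarrow> - (\<epsilon> * c * s) - 0 * (1 + s\<^sup>2) / 2"
        by (intro tendsto_intros tr) simp
      then show "(\<lambda>n. - (\<epsilon> * c * s) - t (r n) * (1 + s\<^sup>2) / 2) \<longlonglongrightarrow> - (\<epsilon> * c * s)"
        by simp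
    qed (use inner_ge in blast)
    then show "- (\<epsilon> * A_opnorm A T * A_opnorm A S) \<le> A_inner A (T x) (S x)"
      by (simp add: c_def s_def)
  qed
qed

section \<open>Approximate orthogonality and norm-attaining vectors\<close>

theorem theorem2p15:
  fixes A T S :: "'a::{real_inner, complete_space} \<Rightarrow>\<^sub>L 'a" and \<epsilon> :: real
  assumes "positive_op A" and "A \<noteq> 0"
    and "bounded (A_ball A \<inter> closure (range A))"
    and "0 \<le> \<epsilon>" and "\<epsilon> < 1"
    and "T \<in> A_bounded_ops A" and "S \<in> A_bounded_ops A"
    and "compact_op T" and "compact_op S"
  shows "approx_orthogonal \<epsilon> A T S \<longleftrightarrow>
    (\<exists>x. A_norm A x = 1 \<and> A_norm A (T x) = A_opnorm A T \<and>
         \<bar>A_inner A (T x) (S x)\<bar> \<le> \<epsilon> * A_opnorm A T * A_opnorm A S)"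
proof
  note pos = assms(1) and A0 = assms(2) and T = assms(6) and S = assms(7)
  define k where "k = \<epsilon> * A_opnorm A T * A_opnorm A S"
  have k: "0 \<le> k"
    unfolding k_def
    using assms(4) A_opnorm_nonneg[OF pos A0 T] A_opnorm_nonneg[OF pos A0 S] by simp
  assume orth: "approx_orthogonal \<epsilon> A T S"
  show "\<exists>x. A_norm A x = 1 \<and> A_norm A (T x) = A_opnorm A T \<and>
         \<bar>A_inner A (T x) (S x)\<bar> \<le> \<epsilon> * A_opnorm A T * A_opnorm A S"
  \<comment> \<open>If the seminorm of \<open>T\<close> is zero, every unit vector works by
    Cauchy-Schwarz. Otherwise the perturbation argument applies.\<close>
  proof (cases "A_opnorm A T = 0")
    case True
    obtain x where x: "A_norm A x = 1"
      using A_norm_unit_exists[OF pos A0] .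
    have "A_norm A (T x) = 0"
      using A_opnorm_upper_unit[OF pos T x] A_norm_nonneg[OF pos, of "T x"] True by linarith
    moreover from this have "\<bar>A_inner A (T x) (S x)\<bar> \<le> 0"
      using A_Cauchy_Schwarz[OF pos, of "T x" "S x"] by simp
    ultimately show ?thesis using x True by auto
  next
    case False
    then have c: "0 < A_opnorm A T"
      using A_opnorm_nonneg[OF pos A0 T] by linarith
    have S': "- S \<in> A_bounded_ops A"
      using A_bounded_ops_scaleR[OF pos S, of "-1"] by simp
    have nS: "A_opnorm A (- S) = A_opnorm A S"
      using A_opnorm_scaleR[OF pos A0 S, of "-1"] by simp
    obtain x where x: "A_norm A x = 1" "A_norm A (T x) = A_opnorm A T"
      "- k \<le> A_inner A (T x) (S x)"
      by (rule A_opnorm_attained_lower_bound[OF pos A0 assms(3) T S assms(8) c assms(4) orth,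
            folded k_def])
    obtain y where y: "A_norm A y = 1" "A_norm A (T y) = A_opnorm A T"
      "- k \<le> A_inner A (T y) ((- S) y)"
      by (rule A_opnorm_attained_lower_bound[OF pos A0 assms(3) T S' assms(8) c assms(4)
            approx_orthogonal_minus[OF pos A0 S orth], unfolded nS, folded k_def])
    have yk: "A_inner A (T y) (S y) \<le> k"
      using y(3) by (simp add: blinfun.minus_left A_inner_simps)
    show ?thesis
    proof (cases "A_inner A (T x) (S x) \<le> k")
      case True
      with x show ?thesis
        by (intro exI[of _ x]) (simp add: k_def [symmetric] abs_le_iff minus_le_iff)
    next
      case False
      \<comment> \<open>The sign change makes the inner product with \<open>x\<close> nonnegative
        and leaves all conditions on \<open>y\<close> intact, as they are even in
        \<open>y\<close>.\<close>
      define y' where "y' = (if A_inner A x y \<ge> 0 then y else - y)"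
      have y': "A_norm A y' = 1" "A_norm A (T y') = A_opnorm A T" "A_inner A x y' \<ge> 0"
        "A_inner A (T y') (S y') \<le> k"
        using y(1,2) yk
        by (simp_all add: y'_def blinfun.minus_right A_norm_minus[OF pos] A_inner_simps)
      have kx: "k \<le> A_inner A (T x) (S x)"
        using False by simp
      have "\<exists>z. A_norm A z = 1 \<and> A_norm A (T z) = A_opnorm A T \<and> A_inner A (T z) (S z) = k"
        by (rule A_opnorm_attained_segment[OF pos T x(1,2) y'(1-3) kx y'(4)])
      then obtain z where z: "A_norm A z = 1" "A_norm A (T z) = A_opnorm A T"
          "A_inner A (T z) (S z) = k"
        by blast
      show ?thesis
        unfolding k_def [symmetric] using z k by (intro exI[of _ z]) simp
    qed
  qed
next
  note pos = assms(1) and A0 = assms(2) and T = assms(6) and S = assms(7)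
  assume "\<exists>x. A_norm A x = 1 \<and> A_norm A (T x) = A_opnorm A T \<and>
         \<bar>A_inner A (T x) (S x)\<bar> \<le> \<epsilon> * A_opnorm A T * A_opnorm A S"
  then obtain x where x: "A_norm A x = 1" "A_norm A (T x) = A_opnorm A T"
    "\<bar>A_inner A (T x) (S x)\<bar> \<le> \<epsilon> * A_opnorm A T * A_opnorm A S" by blast
  show "approx_orthogonal \<epsilon> A T S"
    unfolding approx_orthogonal_def
  proof
    fix t :: real
    have "T + t *\<^sub>R S \<in> A_bounded_ops A"
      by (intro A_bounded_ops_add A_bounded_ops_scaleR pos T S)
    then have "A_norm A ((T + t *\<^sub>R S) x) \<le> A_opnorm A (T + t *\<^sub>R S)"
      by (rule A_opnorm_upper_unit[OF pos _ x(1)])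
    then have le: "(A_norm A (T x + t *\<^sub>R S x))\<^sup>2 \<le> (A_opnorm A (T + t *\<^sub>R S))\<^sup>2"
      using A_norm_nonneg[OF pos] by (intro power_mono) (auto simp: blinfun.bilinear_simps)
    \<comment> \<open>With \<open>T + t *\<^sub>R S\<close> tested at \<open>x\<close>, the square
      expands into three terms: the cross term is bounded by the hypothesis on \<open>x\<close>, and
      the last one is nonnegative.\<close>
    have "\<bar>t * A_inner A (T x) (S x)\<bar> \<le> \<bar>t\<bar> * (\<epsilon> * A_opnorm A T * A_opnorm A S)"
      unfolding abs_mult by (intro mult_left_mono x(3)) simp
    then have "- (\<bar>t\<bar> * (\<epsilon> * A_opnorm A T * A_opnorm A S)) \<le> t * A_inner A (T x) (S x)"
      by linarith
    then have "(A_opnorm A T)\<^sup>2 - 2 * (\<bar>t\<bar> * (\<epsilon> * A_opnorm A T * A_opnorm A S))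
        \<le> (A_norm A (T x + t *\<^sub>R S x))\<^sup>2"
      unfolding A_norm_add_sq[OF pos] x(2) A_inner_simps
      using zero_le_power2[of "A_norm A (t *\<^sub>R S x)"] by linarith
    with le show "(A_opnorm A (T + t *\<^sub>R S))\<^sup>2
        \<ge> (A_opnorm A T)\<^sup>2 - 2 * \<epsilon> * A_opnorm A T * A_opnorm A (t *\<^sub>R S)"
      unfolding A_opnorm_scaleR[OF pos A0 S] by (simp add: mult_ac)
  qed
qed

end
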